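(* Let $(G,H,\mathcal{L})$ be a cut-and-project scheme and let $W\subseteq H$ be compact. Let $\mu$ be any positive, translation bounded measure on $G$ with $\operatorname{supp}(\mu)\subseteq\curlywedge(W)$. Let $\gamma$ be any autocorrelation of $\mu$, and assume that $$I:=\widehat\gamma(\{0\})>0 .$$ Then: (a) The measure $\mu$ has a Bragg peak at each $\chi\in B_1$, of intensity $\widehat\gamma(\{\chi\})\ \ge\ (1-s(\chi))\,I\ >0$. (b) For each $0<\varepsilon<1$ and each $\chi\in B_\varepsilon$, $\mu$ has a Bragg peak at $\chi$ of intensity $\widehat\gamma(\{\chi\})\ \ge\ (1-\varepsilon)\,I$.
   Context: $G$ is a second countable locally compact Abelian group (LCAG) with Haar measure $|\cdot|$; dual groups are written additively, with $0$ the trivial character. A measure $\mu$ is translation bounded if $\sup_{t\in G}|\mu|(t+K)<\infty$ for all compact $K\subseteq G$. A cut-and-project scheme (CPS) $(G,H,\mathcal{L})$ consists of $G$, an LCAG $H$ and a lattice (discrete co-compact subgroup) $\mathcal{L}\subseteq G\times H$ such that the projection $\pi_G$ is one-to-one on $\mathcal{L}$ and $\pi_H(\mathcal{L})$ is dense in $H$. For $W\subseteq H$, $\curlywedge(W):=\{\pi_G(l): l\in\mathcal{L},\ \pi_H(l)\in W\}$. The annihilator $\mathcal{L}^0=\{(\chi,\psi)\in\widehat G\times\widehat H:\chi(x)\psi(y)=1\ \forall (x,y)\in\mathcal{L}\}$ is a lattice and $(\widehat G,\widehat H,\mathcal{L}^0)$ is a CPS. Elements of $\mathcal{L}^0$ are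 written $(\chi,\chi^\star)$. For $V\subseteq\widehat H$, $\curlywedge^\star(V):=\{\chi:(\chi,\chi^\star)\in\mathcal{L}^0,\ \chi^\star\in V\}$. For $\varepsilon>0$ set $W_\varepsilon:=\{\psi\in\widehat H:|\psi(t)-1|<\varepsilon\ \forall t\in W-W\}$ and $B_\varepsilon:=\curlywedge^\star(W_\varepsilon)$. For $(\chi,\chi^\star)\in\mathcal{L}^0$ set $s(\chi):=\sup\{|\chi^\star(t)-1|:t\in W-W\}$. Autocorrelation: a van Hove sequence $(A_n)$ in $G$ is a sequence of compact sets of positive Haar measure with $|\partial^K A_n|/|A_n|\to 0$ for every compact $K\subseteq G$, where $\partial^K A=\overline{(A+K)\setminus A}\cup((\overline{G\setminus A}-K)\cap A)$. An autocorrelation of $\mu$ is a vague limit, along some van Hove sequence (possibly after passing to a subsequence), of $\frac{1}{|A_n|}\mu|_{A_n}*\widetilde{\mu|_{A_n}}$, where $\widetilde{\mu}(B)=\overline{\mu(-B)}$. It is positive definite and $\widehat\gamma$ is the unique positive measure on $\widehat G$ with $\int \varphi*\tilde\varphi\,d\gamma=\int|\check\varphi|^2\,d\widehat\gamma$ for all $\varphi\in C_c(G)$, where $\tilde\varphi(x)=\overline{\varphi(-x)}$ and $\check\varphi(\chi)=\int_G\chi(x)\varphi(x)\,dx$. $\mu$ has a Bragg peak at $\chi$ if $\widehat\gamma(\{\chi\})>0$; this number is its intensity. *)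

theory Defs
  imports "HOL-Analysis.Analysis"
begin

section \<open>The dual group\<close>

typedef (overloaded) 'g character =
  "{\<omega> :: ('g::topological_ab_group_add \<Rightarrow> complex).
      continuous_on UNIV \<omega> \<and> (\<forall>x. cmod (\<omega> x) = 1) \<and> (\<forall>x y. \<omega> (x + y) = \<omega> x * \<omega> y)}"
  morphisms char_fun Abs_character
  by (intro exI[of _ "\<lambda>_. 1"]) simp

setup_lifting type_definition_character

text \<open>The group of characters is written additively: \<open>0\<close> is the trivial character and
  \<open>\<omega> + \<psi>\<close> is the pointwise product.\<close>

instantiation character :: (topological_ab_group_add) ab_group_add
begin

lift_definition zero_character :: "'a character" is "\<lambda>_. 1" by simp

lift_definition plus_character :: "'a character \<Rightarrow> 'a character \<Rightarrow> 'a character"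
  is "\<lambda>\<omega> \<psi> x. \<omega> x * \<psi> x"
  by (auto intro: continuous_on_mult simp: norm_mult)

lift_definition uminus_character :: "'a character \<Rightarrow> 'a character"
  is "\<lambda>\<omega> x. cnj (\<omega> x)"
  by (auto intro: continuous_on_cnj)

definition minus_character :: "'a character \<Rightarrow> 'a character \<Rightarrow> 'a character" where
  "minus_character \<omega> \<psi> = \<omega> + (- \<psi>)"

instance
proof
  fix a b c :: "'a character"
  show "a + b + c = a + (b + c)" by transfer (simp add: mult.assoc)
  show "a + b = b + a" by transfer (simp add: mult.commute)
  show "0 + a = a" by transfer simp
  have "cnj z * z = 1" if "cmod z = 1" for z
    using that complex_norm_square[of z] by (simp add: mult.commute)
  then show "- a + a = 0"
    by transfer blast
  show "a - b = a + - b" by (rule minus_character_def)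
qed

end

text \<open>The topology of the dual group is the compact-open topology.\<close>

instantiation character :: (topological_ab_group_add) topological_space
begin

definition open_character :: "'a character set \<Rightarrow> bool" where
  "open_character = generate_topology
     {{\<omega>. char_fun \<omega> ` K \<subseteq> U} | K U. compact K \<and> open U}"

instance
proof
  show "open (UNIV :: 'a character set)"
    unfolding open_character_def by (rule generate_topology.UNIV)
  show "open (S \<inter> T)" if "open S" "open T" for S T :: "'a character set"
    using that unfolding open_character_def by (rule generate_topology.Int)
  show "open (\<Union>\<K>)" if "\<forall>S\<in>\<K>. open S" for \<K> :: "'a character set set"
    using that unfolding open_character_def by (intro generate_topology.UN) blast
qed

end

text \<open>In particular singletons are Borel sets of the dual group.\<close>

instance character :: (topological_ab_group_add) t2_space
proof
  fix \<omega> \<psi> :: "'a character"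
  assume "\<omega> \<noteq> \<psi>"
  then have "char_fun \<omega> \<noteq> char_fun \<psi>"
    by (simp add: char_fun_inject)
  then obtain x where x: "char_fun \<omega> x \<noteq> char_fun \<psi> x"
    by blast
  from hausdorff[OF x] obtain U V where
    UV: "open U" "open V" "char_fun \<omega> x \<in> U" "char_fun \<psi> x \<in> V" "U \<inter> V = {}"
    by (elim exE conjE)
  have *: "open {\<phi> :: 'a character. char_fun \<phi> ` {x} \<subseteq> S}" if "open S" for S
  proof -
    have "compact {x}" by (rule compact_sing)
    with that show ?thesis
      unfolding open_character_def by (intro generate_topology.Basis CollectI exI[of _ "{x}"] exI[of _ S] conjI refl)
  qed
  have "\<omega> \<in> {\<phi>. char_fun \<phi> ` {x} \<subseteq> U}" "\<psi> \<in> {\<phi>. char_fun \<phi> ` {x} \<subseteq> V}"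
    "{\<phi>. char_fun \<phi> ` {x} \<subseteq> U} \<inter> {\<phi>. char_fun \<phi> ` {x} \<subseteq> V} = {}"
    using UV(3-5) by auto
  with *[OF UV(1)] *[OF UV(2)]
  show "\<exists>U V. open U \<and> open V \<and> \<omega> \<in> U \<and> \<psi> \<in> V \<and> U \<inter> V = {}"
    by (intro exI conjI)
qed


section \<open>Cut-and-project schemes\<close>

definition coset :: "'a::ab_group_add set \<Rightarrow> 'a \<Rightarrow> 'a set" where
  "coset L p = (\<lambda>l. p + l) ` L"

definition quotient_topology :: "'a::{ab_group_add,topological_space} set \<Rightarrow> 'a set topology" where
  "quotient_topology L = topology (\<lambda>U. U \<subseteq> range (coset L) \<and> open (coset L -` U))"

lemma openin_quotient_topology:
  "openin (quotient_topology L) U \<longleftrightarrow> U \<subseteq> range (coset L) \<and> open (coset L -` U)"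
proof -
  have "istopology (\<lambda>U. U \<subseteq> range (coset L) \<and> open (coset L -` U))"
    unfolding istopology_def
  proof (intro conjI allI impI; (elim conjE)?)
    fix S T assume "S \<subseteq> range (coset L)" "open (coset L -` S)" "open (coset L -` T)"
    then show "S \<inter> T \<subseteq> range (coset L)" "open (coset L -` (S \<inter> T))"
      by auto
  next
    fix \<K> assume *: "\<forall>K\<in>\<K>. K \<subseteq> range (coset L) \<and> open (coset L -` K)"
    then show "\<Union>\<K> \<subseteq> range (coset L)" by blast
    show "open (coset L -` \<Union>\<K>)" using * by (auto simp: vimage_Union)
  qed
  then show ?thesis by (simp add: quotient_topology_def)
qed

definition subgroup :: "'a::ab_group_add set \<Rightarrow> bool" where
  "subgroup L \<longleftrightarrow> 0 \<in> L \<and> (\<forall>x\<in>L. \<forall>y\<in>L. x - y \<in> L)"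

definition lattice_in :: "'a::{ab_group_add,topological_space} set \<Rightarrow> bool" where
  "lattice_in L \<longleftrightarrow> subgroup L \<and> discrete L \<and> compact_space (quotient_topology L)"

definition cut_and_project_scheme ::
    "('g::{topological_ab_group_add,t2_space} \<times> 'h::{topological_ab_group_add,t2_space}) set \<Rightarrow> bool" where
  "cut_and_project_scheme L \<longleftrightarrow>
     locally_compact_space (euclidean :: 'g topology) \<and>
     locally_compact_space (euclidean :: 'h topology) \<and>
     lattice_in L \<and> inj_on fst L \<and> closure (snd ` L) = UNIV"

definition cut_set :: "('a \<times> 'b) set \<Rightarrow> 'b set \<Rightarrow> 'a set" where
  "cut_set L W = {fst l | l. l \<in> L \<and> snd l \<in> W}"

definition annihilator ::
    "('g::topological_ab_group_add \<times> 'h::topological_ab_group_add) set \<Rightarrow> ('g character \<times> 'h character) set" where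
  "annihilator L = {(\<omega>, \<psi>). \<forall>(x, y)\<in>L. char_fun \<omega> x * char_fun \<psi> y = 1}"

text \<open>For a cut-and-project scheme the projection of the annihilator to the dual of \<open>G\<close> is
  one-to-one, so the description below determines \<open>\<omega>\<^sup>\<star>\<close> whenever \<open>\<omega>\<close> lies in that projection.\<close>

definition star_map ::
    "('g::topological_ab_group_add \<times> 'h::topological_ab_group_add) set \<Rightarrow> 'g character \<Rightarrow> 'h character" where
  "star_map L \<omega> = (THE \<psi>. (\<omega>, \<psi>) \<in> annihilator L)"

definition difference_set :: "'a::ab_group_add set \<Rightarrow> 'a set \<Rightarrow> 'a set" where
  "difference_set A B = {a - b | a b. a \<in> A \<and> b \<in> B}"

definition dual_window :: "'h::topological_ab_group_add set \<Rightarrow> real \<Rightarrow> 'h character set" where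
  "dual_window W \<epsilon> = {\<psi>. \<forall>t\<in>difference_set W W. cmod (char_fun \<psi> t - 1) < \<epsilon>}"

definition dual_cut_set ::
    "('g::topological_ab_group_add \<times> 'h::topological_ab_group_add) set \<Rightarrow> 'h set \<Rightarrow> real \<Rightarrow> 'g character set" where
  "dual_cut_set L W \<epsilon> = cut_set (annihilator L) (dual_window W \<epsilon>)"

definition star_deviation ::
    "('g::topological_ab_group_add \<times> 'h::topological_ab_group_add) set \<Rightarrow> 'h set \<Rightarrow> 'g character \<Rightarrow> real" where
  "star_deviation L W \<omega> = (SUP t\<in>difference_set W W. cmod (char_fun (star_map L \<omega>) t - 1))"


section \<open>Measures\<close>

text \<open>Positive Radon measures are represented by Borel measures which are finite on compact sets.
  These are automatically regular on the second countable locally compact Hausdorff spaces to which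
  the definition is applied (the group \<open>G\<close> and its dual).\<close>

definition radon_measure :: "'a::topological_space measure \<Rightarrow> bool" where
  "radon_measure \<mu> \<longleftrightarrow> sets \<mu> = sets borel \<and> (\<forall>K. compact K \<longrightarrow> emeasure \<mu> K < \<infinity>)"

definition haar_measure :: "'g::topological_ab_group_add measure \<Rightarrow> bool" where
  "haar_measure m \<longleftrightarrow> radon_measure m \<and> emeasure m UNIV \<noteq> 0 \<and>
     (\<forall>x. \<forall>A\<in>sets borel. emeasure m ((\<lambda>a. x + a) ` A) = emeasure m A)"

definition translation_bounded :: "'g::topological_ab_group_add measure \<Rightarrow> bool" where
  "translation_bounded \<mu> \<longleftrightarrow>
     (\<forall>K. compact K \<longrightarrow> (SUP t. emeasure \<mu> ((\<lambda>k. t + k) ` K)) < \<infinity>)"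

definition measure_support :: "'a::topological_space measure \<Rightarrow> 'a set" where
  "measure_support \<mu> = {x. \<forall>U. open U \<and> x \<in> U \<longrightarrow> emeasure \<mu> U \<noteq> 0}"

definition van_Hove_boundary :: "'g::topological_ab_group_add set \<Rightarrow> 'g set \<Rightarrow> 'g set" where
  "van_Hove_boundary K A =
     closure ({a + k | a k. a \<in> A \<and> k \<in> K} - A) \<union> (difference_set (closure (- A)) K \<inter> A)"

definition van_Hove_sequence ::
    "'g::topological_ab_group_add measure \<Rightarrow> (nat \<Rightarrow> 'g set) \<Rightarrow> bool" where
  "van_Hove_sequence m A \<longleftrightarrow>
     (\<forall>n. compact (A n) \<and> measure m (A n) > 0) \<and>
     (\<forall>K. compact K \<longrightarrow>
        (\<lambda>n. measure m (van_Hove_boundary K (A n)) / measure m (A n)) \<longlonglongrightarrow> 0)"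

definition C_c :: "('a::topological_space \<Rightarrow> complex) set" where
  "C_c = {f. continuous_on UNIV f \<and> compact (closure {x. f x \<noteq> 0})}"

text \<open>The library's convolution of measures is only available on Euclidean spaces.\<close>

definition measure_convolution ::
    "'g::topological_ab_group_add measure \<Rightarrow> 'g measure \<Rightarrow> 'g measure" where
  "measure_convolution \<mu> \<nu> = distr (\<mu> \<Otimes>\<^sub>M \<nu>) borel (\<lambda>(x, y). x + y)"

text \<open>For a positive measure the complex conjugation in \<open>B \<mapsto> cnj (\<mu> (- B))\<close> is vacuous.\<close>

definition reflected_measure :: "'g::topological_ab_group_add measure \<Rightarrow> 'g measure" where
  "reflected_measure \<mu> = distr \<mu> borel uminus"

definition finite_autocorrelation ::
    "'g::topological_ab_group_add measure \<Rightarrow> 'g measure \<Rightarrow> 'g set \<Rightarrow> 'g measure" where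
  "finite_autocorrelation m \<mu> A =
     scale_measure (1 / emeasure m A)
       (measure_convolution (density \<mu> (indicator A)) (reflected_measure (density \<mu> (indicator A))))"

definition vague_limit :: "(nat \<Rightarrow> 'a::topological_space measure) \<Rightarrow> 'a measure \<Rightarrow> bool" where
  "vague_limit \<nu> \<gamma> \<longleftrightarrow> radon_measure \<gamma> \<and>
     (\<forall>f\<in>C_c. (\<lambda>n. integral\<^sup>L (\<nu> n) f) \<longlonglongrightarrow> integral\<^sup>L \<gamma> f)"

definition autocorrelation ::
    "'g::topological_ab_group_add measure \<Rightarrow> 'g measure \<Rightarrow> 'g measure \<Rightarrow> bool" where
  "autocorrelation m \<mu> \<gamma> \<longleftrightarrow>
     (\<exists>A r. van_Hove_sequence m A \<and> strict_mono (r :: nat \<Rightarrow> nat) \<and>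
        vague_limit (\<lambda>n. finite_autocorrelation m \<mu> (A (r n))) \<gamma>)"


section \<open>The Fourier transform of a positive definite measure\<close>

definition fun_convolution ::
    "'g::topological_ab_group_add measure \<Rightarrow> ('g \<Rightarrow> complex) \<Rightarrow> ('g \<Rightarrow> complex) \<Rightarrow> 'g \<Rightarrow> complex" where
  "fun_convolution m f g x = (LINT y|m. f y * g (x - y))"

definition tilde :: "('g::ab_group_add \<Rightarrow> complex) \<Rightarrow> 'g \<Rightarrow> complex" where
  "tilde f x = cnj (f (- x))"

definition inverse_fourier ::
    "'g::topological_ab_group_add measure \<Rightarrow> ('g \<Rightarrow> complex) \<Rightarrow> 'g character \<Rightarrow> complex" where
  "inverse_fourier m f \<omega> = (LINT x|m. char_fun \<omega> x * f x)"

text \<open>Integrability is required explicitly because the Bochner integral of a non-integrable function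
  is \<open>0\<close>.\<close>

definition fourier_transform ::
    "'g::topological_ab_group_add measure \<Rightarrow> 'g measure \<Rightarrow> 'g character measure \<Rightarrow> bool" where
  "fourier_transform m \<gamma> \<gamma>h \<longleftrightarrow> radon_measure \<gamma>h \<and>
     (\<forall>\<phi>\<in>C_c. integrable \<gamma>h (\<lambda>\<omega>. (cmod (inverse_fourier m \<phi> \<omega>))\<^sup>2) \<and>
        (LINT x|\<gamma>. fun_convolution m \<phi> (tilde \<phi>) x) =
          complex_of_real (LINT \<omega>|\<gamma>h. (cmod (inverse_fourier m \<phi> \<omega>))\<^sup>2))"

text \<open>The argument \<open>\<gamma>h\<close> is the Fourier transform of an autocorrelation. A Radon measure is finite
  on singletons, so no information is lost by taking real values.\<close>

definition intensity :: "'g::topological_ab_group_add character measure \<Rightarrow> 'g character \<Rightarrow> real" where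
  "intensity \<gamma>h \<omega> = measure \<gamma>h {\<omega>}"

definition bragg_peak :: "'g::topological_ab_group_add character measure \<Rightarrow> 'g character \<Rightarrow> bool" where
  "bragg_peak \<gamma>h \<omega> \<longleftrightarrow> intensity \<gamma>h \<omega> > 0"

end

theory Submission
  imports Defs
begin

text \<open>The measures \<open>1/|A n| \<mu>|A n * reflected \<mu>|A n\<close> are concentrated on differences of points of
  \<open>cut_set L W\<close>, where a character \<open>\<omega>\<close> with \<open>(\<omega>, \<psi>) \<in> annihilator L\<close> differs from \<open>1\<close> by at most
  \<open>s = sup |\<psi> - 1|\<close> over \<open>W - W\<close>. Hence \<open>|\<integral> cnj \<omega> h d\<gamma> - \<integral> h d\<gamma>| \<le> s \<integral> h d\<gamma>\<close> for \<open>h = \<phi> * tilde \<phi>\<close> with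
  \<open>\<phi> \<ge> 0\<close>. On the Fourier side this says that shifting the argument of \<open>inverse_fourier m \<phi>\<close> by \<open>\<omega>\<close>
  loses at most the factor \<open>1 - s\<close> in its \<open>\<gamma>h\<close>-square integral. For \<open>\<phi>\<close> the convolution of a fixed
  \<open>f \<ge> 0\<close> with the uniform distribution on \<open>A n\<close>, the square integrals converge to
  \<open>|\<integral> f|\<^sup>2 \<gamma>h {\<omega>}\<close> and \<open>|\<integral> f|\<^sup>2 \<gamma>h {0}\<close> by dominated convergence.\<close>

section \<open>Continuous functions of compact support\<close>

lemma C_cI:
  fixes f :: "'a::t2_space \<Rightarrow> complex"
  assumes "continuous_on UNIV f" "compact K" "\<And>x. x \<notin> K \<Longrightarrow> f x = 0"
  shows "f \<in> C_c"
proof -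
  have "closure {x. f x \<noteq> 0} \<subseteq> K"
    using assms by (intro closure_minimal compact_imp_closed) auto
  then have "compact (K \<inter> closure {x. f x \<noteq> 0})"
    using assms by (intro compact_Int_closed) auto
  moreover have "K \<inter> closure {x. f x \<noteq> 0} = closure {x. f x \<noteq> 0}"
    using \<open>closure {x. f x \<noteq> 0} \<subseteq> K\<close> by blast
  ultimately show ?thesis
    using assms by (simp add: C_c_def)
qed

lemma C_cE:
  fixes f :: "'a::t2_space \<Rightarrow> complex"
  assumes "f \<in> C_c"
  obtains K B where "continuous_on UNIV f" "compact K" "\<And>x. x \<notin> K \<Longrightarrow> f x = 0"
    "\<And>x. cmod (f x) \<le> B"
proof -
  let ?K = "closure {x. f x \<noteq> 0}"
  have f: "continuous_on UNIV f" "compact ?K"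
    using assms by (auto simp: C_c_def)
  then have "bounded (f ` ?K)"
    by (intro compact_imp_bounded compact_continuous_image continuous_on_subset[OF f(1)]) auto
  then obtain B where B: "\<And>x. x \<in> ?K \<Longrightarrow> cmod (f x) \<le> B"
    unfolding bounded_iff by auto
  have zero: "f x = 0" if "x \<notin> ?K" for x
    using that closure_subset[of "{x. f x \<noteq> 0}"] by blast
  have "cmod (f x) \<le> max 0 B" for x
    using B[of x] zero[of x] by (cases "x \<in> ?K") auto
  with f zero show ?thesis
    by (intro that[of ?K "max 0 B"])
qed

lemma C_c_mult:
  fixes f g :: "'a::t2_space \<Rightarrow> complex"
  assumes "continuous_on UNIV g" "f \<in> C_c"
  shows "(\<lambda>x. g x * f x) \<in> C_c"
proof -
  obtain K B where K: "continuous_on UNIV f" "compact K" "\<And>x. x \<notin> K \<Longrightarrow> f x = 0"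
    "\<And>x. cmod (f x) \<le> B"
    using C_cE[OF assms(2)] by metis
  show ?thesis
    by (rule C_cI[OF _ K(2)]) (auto intro!: continuous_on_mult assms K)
qed

lemma tilde_in_C_c:
  fixes f :: "'a::{topological_ab_group_add,t2_space} \<Rightarrow> complex"
  assumes "f \<in> C_c"
  shows "tilde f \<in> C_c"
proof -
  obtain K B where K: "continuous_on UNIV f" "compact K" "\<And>x. x \<notin> K \<Longrightarrow> f x = 0"
    "\<And>x. cmod (f x) \<le> B"
    using C_cE[OF assms] by metis
  show ?thesis
  proof (rule C_cI)
    show "continuous_on UNIV (tilde f)"
      unfolding tilde_def
      by (intro continuous_on_cnj continuous_on_compose2[OF K(1)] continuous_intros) auto
    show "compact (uminus ` K)"
      by (intro compact_continuous_image continuous_intros K)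
    show "tilde f x = 0" if "x \<notin> uminus ` K" for x
    proof -
      have "- x \<notin> K"
        using that by (metis imageI minus_minus)
      then show ?thesis
        by (simp add: tilde_def K)
    qed
  qed
qed

lemma C_c_borel_measurable:
  fixes f :: "'a::t2_space \<Rightarrow> complex"
  assumes "f \<in> C_c" "sets M = sets borel"
  shows "f \<in> borel_measurable M"
  using assms by (auto simp: C_c_def measurable_cong_sets[OF assms(2) refl]
      intro: borel_measurable_continuous_onI)

lemma C_c_integrable:
  fixes f :: "'a::t2_space \<Rightarrow> complex"
  assumes "f \<in> C_c" "radon_measure M"
  shows "integrable M f"
proof -
  obtain K B where K: "continuous_on UNIV f" "compact K" "\<And>x. x \<notin> K \<Longrightarrow> f x = 0"
    "\<And>x. cmod (f x) \<le> B"
    using C_cE[OF assms(1)] by metis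
  show ?thesis
  proof (rule integrableI_bounded_set)
    show "K \<in> sets M" "emeasure M K < \<infinity>"
      using assms K by (auto simp: radon_measure_def compact_imp_closed)
    show "f \<in> borel_measurable M"
      using assms by (auto intro: C_c_borel_measurable simp: radon_measure_def)
    show "AE x \<in> K in M. norm (f x) \<le> B"
      using K by auto
    show "AE x in M. x \<notin> K \<longrightarrow> f x = 0"
      using K by auto
  qed
qed


section \<open>Characters\<close>

lemma continuous_on_char_fun [continuous_intros]: "continuous_on S (char_fun \<omega>)"
  using char_fun[of \<omega>] by (auto intro: continuous_on_subset)

lemma cmod_char_fun [simp]: "cmod (char_fun \<omega> x) = 1"
  using char_fun[of \<omega>] by auto

lemma char_fun_add: "char_fun \<omega> (x + y) = char_fun \<omega> x * char_fun \<omega> y"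
  using char_fun[of \<omega>] by auto

lemma char_fun_cnj_mult [simp]: "char_fun \<omega> x * cnj (char_fun \<omega> x) = 1"
  by (simp add: complex_norm_square[symmetric])

lemma char_fun_zero [simp]: "char_fun \<omega> 0 = 1"
proof -
  have "char_fun \<omega> 0 * char_fun \<omega> 0 = char_fun \<omega> 0"
    by (simp flip: char_fun_add)
  moreover have "char_fun \<omega> 0 \<noteq> 0"
    using cmod_char_fun[of \<omega> 0] by (metis norm_zero zero_neq_one)
  ultimately show ?thesis
    by simp
qed

lemma char_fun_minus: "char_fun \<omega> (- x) = cnj (char_fun \<omega> x)"
proof -
  have "char_fun \<omega> (- x) = char_fun \<omega> (- x) * (char_fun \<omega> x * cnj (char_fun \<omega> x))"
    by simp
  also have "\<dots> = char_fun \<omega> (- x + x) * cnj (char_fun \<omega> x)"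
    by (simp only: char_fun_add mult.assoc)
  finally show ?thesis
    by simp
qed

lemma char_fun_diff: "char_fun \<omega> (x - y) = char_fun \<omega> x * cnj (char_fun \<omega> y)"
  using char_fun_add[of \<omega> x "- y"] by (simp add: char_fun_minus)

lemma char_fun_character_add: "char_fun (\<omega> + \<psi>) x = char_fun \<omega> x * char_fun \<psi> x"
  by transfer simp

lemma char_fun_character_zero [simp]: "char_fun 0 x = 1"
  by transfer simp

lemma char_fun_character_minus: "char_fun (- \<omega>) x = cnj (char_fun \<omega> x)"
  by transfer simp

lemma char_fun_borel_measurable:
  "sets M = sets borel \<Longrightarrow> char_fun \<omega> \<in> borel_measurable M"
  by (simp cong: measurable_cong_sets add: borel_measurable_continuous_onI continuous_on_char_fun)

text \<open>Modulation on the group becomes translation on its dual. This is how test functions that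
  detect the trivial character are moved so as to detect another one.\<close>

lemma inverse_fourier_char_mult:
  "inverse_fourier m (\<lambda>x. char_fun \<eta> x * f x) \<omega> = inverse_fourier m f (\<omega> + \<eta>)"
  by (simp add: inverse_fourier_def char_fun_character_add mult.assoc)

lemma inverse_fourier_zero: "inverse_fourier m f 0 = integral\<^sup>L m f"
  by (simp add: inverse_fourier_def)

lemma cmod_inverse_fourier_le: "cmod (inverse_fourier m f \<omega>) \<le> (LINT x|m. cmod (f x))"
  unfolding inverse_fourier_def
  by (rule order_trans[OF integral_norm_bound]) (simp add: norm_mult)


section \<open>Haar measure\<close>

locale lc_haar =
  fixes m :: "'g::{topological_ab_group_add,t2_space,second_countable_topology} measure"
  assumes haar: "haar_measure m"
    and locally_compact: "locally_compact_space (euclidean :: 'g topology)"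
begin

lemma radon: "radon_measure m"
  using haar by (simp add: haar_measure_def)

lemma sets_m [measurable_cong]: "sets m = sets borel"
  using radon by (simp add: radon_measure_def)

lemma space_m [simp]: "space m = UNIV"
  using sets_eq_imp_space_eq[OF sets_m] by simp

text \<open>Every point has an open neighbourhood inside a compact set, and Lindelof leaves
  countably many of them. The cover yields sigma-finiteness, hence Fubini, and later a compact set
  of positive Haar measure.\<close>

lemma countable_compact_cover:
  obtains F :: "'g set set" where "countable F" "\<Union>F = UNIV" "\<And>K. K \<in> F \<Longrightarrow> compact K"
proof -
  have "\<exists>U K. open U \<and> compact K \<and> x \<in> U \<and> U \<subseteq> K" for x :: 'g
    using locally_compact unfolding locally_compact_space_def by simp
  then obtain U K where UK: "\<And>x::'g. open (U x)" "\<And>x. compact (K x)" "\<And>x. x \<in> U x"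
    "\<And>x. U x \<subseteq> K x"
    by metis
  obtain F where F: "F \<subseteq> range U" "countable F" "\<Union>F = \<Union>(range U)"
    using Lindelof[of "range U"] UK(1) by auto
  obtain T where T: "countable T" "F = U ` T"
    using F(1,2) by (metis countable_subset_image)
  show ?thesis
  proof (rule that[of "K ` T"])
    have "x \<in> \<Union>(K ` T)" for x
    proof -
      have "x \<in> \<Union>F"
        using UK(3) F(3) by blast
      then show ?thesis
        using T UK(4) by blast
    qed
    then show "\<Union>(K ` T) = UNIV" by blast
  qed (use T UK in auto)
qed

lemma sigma_finite: "sigma_finite_measure m"
proof -
  obtain F :: "'g set set" where "countable F" "\<Union>F = UNIV" "\<And>K. K \<in> F \<Longrightarrow> compact K"
    using countable_compact_cover by blast
  then show ?thesis
    using radon by (intro sigma_finite_measure.intro exI[of _ F])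
      (auto simp: radon_measure_def compact_imp_closed less_top)
qed

sublocale sigma_finite_measure m
  by (rule sigma_finite)

sublocale pair_sigma_finite m m
  ..

lemma translation_measurable [measurable]: "(\<lambda>x. a + x) \<in> measurable m borel"
  "(\<lambda>x. x - a) \<in> measurable m borel" "(\<lambda>x. a - x) \<in> measurable m borel"
  by (auto simp: measurable_cong_sets[OF sets_m refl]
      intro!: borel_measurable_continuous_onI continuous_intros)

text \<open>\<open>haar_measure\<close> states invariance for images of sets. Applied to the
  preimage of \<open>A\<close>, whose image is \<open>A\<close> again, it turns into invariance of
  the push-forward, the form that the transfer rules for integrals accept.\<close>

lemma distr_translation: "distr m borel (\<lambda>x. a + x) = m"
proof (rule measure_eqI)
  fix A assume "A \<in> sets (distr m borel (\<lambda>x. a + x))"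
  then have A: "A \<in> sets borel" by simp
  let ?B = "(\<lambda>x. a + x) -` A"
  have "?B \<in> sets m"
    using measurable_sets[OF translation_measurable(1)[of a] A] by simp
  moreover have "\<forall>x. \<forall>A\<in>sets borel. emeasure m ((\<lambda>a. x + a) ` A) = emeasure m A"
    using haar unfolding haar_measure_def by (elim conjE)
  ultimately have "emeasure m ((\<lambda>x. a + x) ` ?B) = emeasure m ?B"
    unfolding sets_m by (elim allE[of _ a] ballE[of _ _ ?B]) auto
  also have "(\<lambda>x. a + x) ` ?B = A"
    by (rule surj_image_vimage_eq) (rule surjI[of _ "\<lambda>y. y - a"], simp)
  finally show "emeasure (distr m borel (\<lambda>x. a + x)) A = emeasure m A"
    using A by (subst emeasure_distr) auto
qed (simp add: sets_m)

lemma
  fixes f :: "'g \<Rightarrow> 'b::{banach, second_countable_topology}"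
  assumes [measurable]: "f \<in> borel_measurable borel"
  shows integral_translation: "(LINT x|m. f (x - a)) = integral\<^sup>L m f"
    and integrable_translation: "integrable m (\<lambda>x. f (x - a)) \<longleftrightarrow> integrable m f"
proof -
  have "integral\<^sup>L m f = integral\<^sup>L (distr m borel (\<lambda>x. - a + x)) f"
    by (simp only: distr_translation)
  also have "\<dots> = (LINT x|m. f (x - a))"
    by (subst integral_distr) (simp_all add: add.commute)
  finally show "(LINT x|m. f (x - a)) = integral\<^sup>L m f" ..
  have "integrable m f \<longleftrightarrow> integrable (distr m borel (\<lambda>x. - a + x)) f"
    by (simp only: distr_translation)
  also have "\<dots> \<longleftrightarrow> integrable m (\<lambda>x. f (x - a))"
    by (subst integrable_distr_eq) (simp_all add: add.commute)
  finally show "integrable m (\<lambda>x. f (x - a)) \<longleftrightarrow> integrable m f" ..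
qed

section \<open>Convolution and its Fourier transform\<close>

lemma continuous_on_fun_convolution:
  assumes f: "integrable m f" and g: "continuous_on UNIV g" "\<And>x. cmod (g x) \<le> B"
  shows "continuous_on UNIV (fun_convolution m f g)"
\<comment> \<open>Second countability reduces continuity to sequences, so dominated convergence with
  majorant \<open>cmod (f y) * B\<close> applies.\<close>
proof (rule continuous_on_sequentiallyI)
  fix u :: "nat \<Rightarrow> 'g" and a assume u: "u \<longlonglongrightarrow> a"
  have [measurable]: "g \<in> borel_measurable borel"
    using g by (intro borel_measurable_continuous_onI)
  note [measurable] = borel_measurable_integrable[OF f]
  show "(\<lambda>n. fun_convolution m f g (u n)) \<longlonglongrightarrow> fun_convolution m f g a"
    unfolding fun_convolution_def
  proof (rule integral_dominated_convergence)
    show "integrable m (\<lambda>y. cmod (f y) * B)"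
      using f by simp
    show "AE y in m. (\<lambda>n. f y * g (u n - y)) \<longlonglongrightarrow> f y * g (a - y)"
    proof (intro always_eventually allI tendsto_mult tendsto_const)
      fix y
      have "isCont g (a - y)"
        using g(1) by (simp add: continuous_on_eq_continuous_at)
      then show "(\<lambda>n. g (u n - y)) \<longlonglongrightarrow> g (a - y)"
        by (rule isCont_tendsto_compose) (intro tendsto_intros u)
    qed
    show "AE y in m. norm (f y * g (u n - y)) \<le> cmod (f y) * B" for n
      by (simp add: norm_mult mult_left_mono g)
  qed measurable
qed

text \<open>Only \<open>g\<close> has to be continuous: it passes its continuity on to the
  convolution. The factor \<open>f\<close> can therefore be a normalised indicator function, as in
  \<open>average_kernel\<close>. The support lies in the compact sum of \<open>K\<close> and
  \<open>K'\<close>.\<close>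

lemma fun_convolution_in_C_c:
  assumes f: "integrable m f" "compact K" "\<And>x. x \<notin> K \<Longrightarrow> f x = 0" and g: "g \<in> C_c"
  shows "fun_convolution m f g \<in> C_c"
proof -
  obtain K' B where K': "continuous_on UNIV g" "compact K'" "\<And>x. x \<notin> K' \<Longrightarrow> g x = 0"
    "\<And>x. cmod (g x) \<le> B"
    using C_cE[OF g] by metis
  show ?thesis
  proof (rule C_cI)
    show "continuous_on UNIV (fun_convolution m f g)"
      using f(1) K'(1,4) by (rule continuous_on_fun_convolution)
    show "compact ((\<lambda>(x, y). x + y) ` (K \<times> K'))"
      using f(2) K'(2) unfolding case_prod_beta
      by (intro compact_continuous_image compact_Times continuous_intros)
    show "fun_convolution m f g x = 0" if x: "x \<notin> (\<lambda>(x, y). x + y) ` (K \<times> K')" for x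
    proof -
      have "f y * g (x - y) = 0" for y
      proof (rule ccontr)
        assume "f y * g (x - y) \<noteq> 0"
        then have "y \<in> K" "x - y \<in> K'"
          using f(3) K'(3) by (metis mult_zero_left, metis mult_zero_right)
        moreover have "x = y + (x - y)" by simp
        ultimately show False
          using x by (metis (mono_tags, lifting) case_prod_conv image_eqI mem_Sigma_iff)
      qed
      then show ?thesis
        by (simp only: fun_convolution_def integral_zero)
    qed
  qed
qed

lemma inverse_fourier_fun_convolution:
  assumes f: "integrable m f" and g: "integrable m g"
  shows "inverse_fourier m (fun_convolution m f g) \<omega> = inverse_fourier m f \<omega> * inverse_fourier m g \<omega>"
proof -
  note [measurable] = borel_measurable_integrable[OF f]
  have gm [measurable]: "g \<in> borel_measurable borel"
    using borel_measurable_integrable[OF g] by (simp add: measurable_cong_sets[OF sets_m refl])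
  note [measurable] = char_fun_borel_measurable[OF sets_m]
  have cm: "char_fun \<omega> \<in> borel_measurable borel"
    by (rule char_fun_borel_measurable) simp
  let ?h = "\<lambda>y x. char_fun \<omega> x * (f y * g (x - y))"
  have [measurable]: "(\<lambda>z. snd z - fst z) \<in> measurable (m \<Otimes>\<^sub>M m) borel"
    by (rule borel_measurable_continuous_Pair[where H = "\<lambda>x y. x - y"])
      (auto intro!: continuous_intros simp: measurable_cong_sets[OF sets_m refl]
        simp flip: measurable_cong_sets[OF refl sets_m])
  \<comment> \<open>Writing x as y + (x - y) splits the character, so for fixed y the integral over
    x is a translate of the one defining the transform of \<open>g\<close>.\<close>
  have eq: "?h y x = (f y * char_fun \<omega> y) * (char_fun \<omega> (x - y) * g (x - y))" for x y
    by (simp add: char_fun_diff algebra_simps)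
  have int: "integrable (m \<Otimes>\<^sub>M m) (case_prod ?h)"
  proof (rule Fubini_integrable)
    show "case_prod ?h \<in> borel_measurable (m \<Otimes>\<^sub>M m)"
      by (simp add: case_prod_beta)
    have "(LINT x|m. norm (?h y x)) = cmod (f y) * (LINT x|m. cmod (g x))" for y
      using integral_translation[of "\<lambda>x. cmod (g x)" y] by (simp add: norm_mult)
    then show "integrable m (\<lambda>y. LINT x|m. norm (case_prod ?h (y, x)))"
      using f by simp
    have "integrable m (?h y)" for y
      unfolding eq using integrable_translation[of "\<lambda>x. char_fun \<omega> x * g x" y] g cm
      by (intro integrable_mult_right)
        (auto intro!: Bochner_Integration.integrable_bound[OF g] simp: norm_mult)
    then show "AE y in m. integrable m (\<lambda>x. case_prod ?h (y, x))"
      by simp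
  qed
  have "inverse_fourier m (fun_convolution m f g) \<omega> = (LINT x|m. LINT y|m. ?h y x)"
    by (simp add: inverse_fourier_def fun_convolution_def)
  also have "\<dots> = (LINT y|m. LINT x|m. ?h y x)"
    by (rule Fubini_integral[OF int])
  also have "\<dots> = (LINT y|m. (f y * char_fun \<omega> y) * inverse_fourier m g \<omega>)"
    unfolding eq using integral_translation[of "\<lambda>x. char_fun \<omega> x * g x"] cm
    by (simp add: inverse_fourier_def)
  also have "\<dots> = inverse_fourier m f \<omega> * inverse_fourier m g \<omega>"
    by (simp add: inverse_fourier_def mult.commute)
  finally show ?thesis .
qed

text \<open>The factor \<open>char_fun \<eta> y * cnj (char_fun \<eta> (y - x))\<close> equals
  \<open>char_fun \<eta> x\<close> for every y and leaves the integral. Thus modulating the test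
  function amounts to integrating \<open>char_fun \<eta>\<close> times the same convolution
  square.\<close>

lemma fun_convolution_char_mult:
  "fun_convolution m (\<lambda>x. char_fun \<eta> x * f x) (tilde (\<lambda>x. char_fun \<eta> x * f x)) x =
     char_fun \<eta> x * fun_convolution m f (tilde f) x"
proof -
  have key: "char_fun \<eta> y * cnj (char_fun \<eta> (y - x)) = char_fun \<eta> x" for y
    using char_fun_diff[of \<eta> y "y - x"] by (metis diff_diff_eq2 add_diff_cancel_left')
  then have eq: "char_fun \<eta> y * f y * (cnj (char_fun \<eta> (y - x)) * cnj (f (y - x))) =
      char_fun \<eta> x * (f y * cnj (f (y - x)))" for y
  proof -
    have *: "a * b * (c * d) = (a * c) * (b * d)" for a b c d :: complex
      by simp
    show ?thesis
      by (subst *[of "char_fun \<eta> y" "f y"], subst key) (rule refl)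
  qed
  show ?thesis
    unfolding fun_convolution_def tilde_def minus_diff_eq complex_cnj_mult
      integral_mult_right_zero[symmetric]
    by (rule Bochner_Integration.integral_cong[OF refl eq])
qed

text \<open>Equality with one's own modulus encodes being real and nonnegative for a complex-valued
  function. The deviation estimate for autocorrelations asks for this of the convolution
  square.\<close>

lemma fun_convolution_nonneg:
  assumes "\<And>x. f x = complex_of_real (cmod (f x))"
  shows "fun_convolution m f (tilde f) x = complex_of_real (cmod (fun_convolution m f (tilde f) x))"
proof -
  have "f y * tilde f (x - y) = complex_of_real (cmod (f y) * cmod (f (y - x)))" for y
    using assms[of y] assms[of "y - x"]
    by (metis complex_cnj_complex_of_real minus_diff_eq of_real_mult tilde_def)
  then have "fun_convolution m f (tilde f) x =
      complex_of_real (LINT y|m. cmod (f y) * cmod (f (y - x)))"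
    by (simp only: fun_convolution_def integral_complex_of_real)
  moreover have "0 \<le> (LINT y|m. cmod (f y) * cmod (f (y - x)))"
    by (intro integral_nonneg_AE) auto
  ultimately show ?thesis
    by simp
qed

text \<open>A Urysohn function that is 1 on a compact set of positive measure and 0 off a relatively
  compact neighbourhood has integral at least the measure of that set.\<close>

lemma exists_C_c_positive_integral:
  obtains f where "f \<in> C_c" "\<And>x. f x = complex_of_real (cmod (f x))" "integral\<^sup>L m f \<noteq> 0"
proof -
  obtain F :: "'g set set" where F: "countable F" "\<Union>F = UNIV" "\<And>K. K \<in> F \<Longrightarrow> compact K"
    using countable_compact_cover by blast
  \<comment> \<open>Otherwise the whole group would be a countable union of null sets, against the
    nontriviality of Haar measure.\<close>
  have "\<exists>K\<in>F. emeasure m K \<noteq> 0"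
  proof (rule ccontr)
    assume "\<not> ?thesis"
    then have "K \<in> null_sets m" if "K \<in> F" for K
      using that F(3)[OF that] by (auto simp: null_sets_def sets_m compact_imp_closed)
    then have "(\<Union>K\<in>F. K) \<in> null_sets m"
      by (intro null_sets_UN' F) auto
    then show False
      using F(2) haar by (simp add: haar_measure_def null_sets_def)
  qed
  then obtain C where C: "compact C" "emeasure m C \<noteq> 0"
    using F by blast
  have haus: "Hausdorff_space (euclidean :: 'g topology)"
    unfolding Hausdorff_space_def by (auto simp: disjnt_def dest!: hausdorff)
  then have "completely_regular_space (euclidean :: 'g topology)"
    by (intro locally_compact_regular_imp_completely_regular_space locally_compact) simp
  moreover obtain U K where UK: "open U" "compact K" "C \<subseteq> U" "U \<subseteq> K"
    using locally_compact C(1) locally_compact_space_compact_closed_compact[of "euclidean :: 'g topology"] haus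
    by auto
  ultimately obtain f :: "'g \<Rightarrow> real" where
    f: "continuous_map euclidean (top_of_set {0..1}) f" "f ` (- U) \<subseteq> {0}" "f ` C \<subseteq> {1}"
    using Urysohn_completely_regular_compact_closed[of 0 1 "euclidean :: 'g topology" C "- U"] C
    by (auto simp: disjnt_def closed_Compl disjoint_eq_subset_Compl)
  have cont: "continuous_on UNIV f" and range: "0 \<le> f x" for x
    using f(1) by (auto simp: continuous_map_in_subtopology)
  define g where "g = (\<lambda>x. complex_of_real (f x))"
  have g: "g \<in> C_c"
  proof (rule C_cI[OF _ UK(2)])
    show "continuous_on UNIV g"
      unfolding g_def by (intro continuous_intros cont)
    show "g x = 0" if "x \<notin> K" for x
      using that f(2) UK(4) by (auto simp: g_def)
  qed
  have "integrable m g"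
    using g radon by (rule C_c_integrable)
  then have int: "integrable m f"
    unfolding g_def by (simp only: complex_of_real_integrable_eq)
  have "emeasure m C < \<infinity>"
    using radon C by (simp add: radon_measure_def)
  then have "0 < measure m C"
    using C(2) by (simp add: measure_def enn2real_positive_iff zero_less_iff_neq_zero)
  also have "measure m C = (LINT x|m. indicator C x)"
    using C by (simp add: sets_m compact_imp_closed)
  also have "\<dots> \<le> (LINT x|m. f x)"
  proof (rule integral_mono[OF _ int])
    show "integrable m (indicator C :: 'g \<Rightarrow> real)"
      using C \<open>emeasure m C < \<infinity>\<close> by (simp add: sets_m compact_imp_closed)
    show "indicator C x \<le> f x" for x
      using f(3) range by (auto simp: indicator_def)
  qed
  finally have "integral\<^sup>L m g \<noteq> 0"
    by (simp add: g_def)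
  moreover have "g x = complex_of_real (cmod (g x))" for x
    by (simp add: g_def range)
  ultimately show ?thesis
    using g that by blast
qed

end

section \<open>Averages along van Hove sequences\<close>

context lc_haar
begin

lemma compact_finite_measure: "compact K \<Longrightarrow> K \<in> fmeasurable m"
  using radon by (auto simp: radon_measure_def fmeasurable_def compact_imp_closed)

lemma
  assumes "A \<in> fmeasurable m"
  shows integrable_complex_indicator: "integrable m (indicator A :: 'g \<Rightarrow> complex)"
    and integral_complex_indicator: "(LINT x|m. indicator A x) = complex_of_real (measure m A)"
proof -
  have "has_bochner_integral m (\<lambda>x. indicator A x *\<^sub>R (1 :: complex)) (measure m A *\<^sub>R 1)"
    using assms by (intro has_bochner_integral_indicator) (auto simp: fmeasurable_def)
  moreover have "(\<lambda>x. indicator A x *\<^sub>R (1 :: complex)) = indicator A"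
    by (auto simp: indicator_def)
  ultimately have *: "has_bochner_integral m (indicator A) (complex_of_real (measure m A))"
    by (simp add: scaleR_conv_of_real)
  then show "integrable m (indicator A :: 'g \<Rightarrow> complex)"
    "(LINT x|m. indicator A x) = complex_of_real (measure m A)"
    by (auto simp: has_bochner_integral_iff)
qed

text \<open>Each piece is a closed subset of a compact set, namely of A + t or of \<open>A\<close>.
  Finiteness matters because \<open>measure\<close> sends sets of infinite measure to 0 and is
  monotone only among finite ones.\<close>

lemma van_Hove_boundary_fmeasurable:
  assumes A: "compact A"
  shows "van_Hove_boundary {t} A \<in> fmeasurable m"
    and "closure ((\<lambda>a. a + t) ` A - A) \<in> fmeasurable m"
proof -
  let ?C = "closure ((\<lambda>a. a + t) ` A - A)"
  have At: "compact ((\<lambda>a. a + t) ` A)"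
    by (intro compact_continuous_image continuous_intros A)
  then have "?C \<subseteq> (\<lambda>a. a + t) ` A"
    by (intro closure_minimal compact_imp_closed) auto
  then have "compact ?C"
    using At by (metis closed_closure compact_Int_closed inf.absorb2)
  then show C: "?C \<in> fmeasurable m"
    by (rule compact_finite_measure)
  have "difference_set (closure (- A)) {t} = (\<lambda>x. x + t) -` closure (- A)"
    by (force simp: difference_set_def)
  then have "closed (difference_set (closure (- A)) {t})"
    by (simp add: closed_vimage continuous_intros)
  then have "compact (difference_set (closure (- A)) {t} \<inter> A)"
    using A by (metis compact_Int_closed inf_commute)
  then have D: "difference_set (closure (- A)) {t} \<inter> A \<in> fmeasurable m"
    by (rule compact_finite_measure)
  have "{a + k |a k. a \<in> A \<and> k \<in> {t}} = (\<lambda>a. a + t) ` A"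
    by auto
  then show "van_Hove_boundary {t} A \<in> fmeasurable m"
    using C D by (simp add: van_Hove_boundary_def fmeasurable.Un)
qed

text \<open>Translating by \<open>t\<close> multiplies the integral of \<open>\<omega>\<close> over \<open>A\<close> by \<open>\<omega> t\<close>, at the cost of an
  error supported on the symmetric difference of \<open>A\<close> and \<open>A + t\<close>.\<close>

lemma char_integral_le_van_Hove_boundary:
  assumes A: "compact A"
  shows "cmod (char_fun \<omega> t - 1) * cmod (LINT x|m. char_fun \<omega> x * indicator A x)
    \<le> 2 * measure m (van_Hove_boundary {t} A)"
proof -
  define C where "C = closure ((\<lambda>a. a + t) ` A - A)"
  have CI: "x \<in> C" if "x - t \<in> A" "x \<notin> A" for x
  proof -
    have "x \<in> (\<lambda>a. a + t) ` A - A"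
      using imageI[OF that(1), of "\<lambda>a. a + t"] that(2) by simp
    then show ?thesis
      unfolding C_def by (rule subsetD[OF closure_subset])
  qed
  have [measurable]: "A \<in> sets borel"
    using A by (simp add: compact_imp_closed)
  have fin: "emeasure m A < \<infinity>"
    using compact_finite_measure[OF A] by (simp add: fmeasurable_def)
  note cm [measurable] = char_fun_borel_measurable[OF sets_m, of \<omega>]
  have [measurable]: "char_fun \<omega> \<in> borel_measurable borel"
    by (rule char_fun_borel_measurable) simp
  have C: "C \<in> fmeasurable m" and V: "van_Hove_boundary {t} A \<in> fmeasurable m"
    unfolding C_def using van_Hove_boundary_fmeasurable[OF A] by auto
  have iA: "integrable m (indicator A :: 'g \<Rightarrow> real)"
    using fin by (simp add: sets_m)
  have iAt: "integrable m (\<lambda>x. indicator A (x - t) :: real)"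
    using iA by (subst integrable_translation) auto
  have iC: "integrable m (\<lambda>x. 2 * indicator C x :: real)"
    using C by (intro integrable_mult_right integrable_real_indicator) (auto simp: fmeasurable_def)
  have i1: "integrable m (\<lambda>x. char_fun \<omega> x * indicator A x)"
    by (rule Bochner_Integration.integrable_bound[OF iA]) (auto simp: norm_mult indicator_def)
  have i2: "integrable m (\<lambda>x. char_fun \<omega> x * indicator A (x - t))"
    by (rule Bochner_Integration.integrable_bound[OF iAt]) (auto simp: norm_mult indicator_def)
  \<comment> \<open>Translation invariance followed by multiplicativity: the factor
    \<open>char_fun \<omega> t\<close> is absorbed and \<open>A\<close> is replaced by A +
    t.\<close>
  have "char_fun \<omega> t * (LINT x|m. char_fun \<omega> x * indicator A x)
      = char_fun \<omega> t * (LINT x|m. char_fun \<omega> (x - t) * indicator A (x - t))"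
    by (subst integral_translation[of "\<lambda>x. char_fun \<omega> x * indicator A x" t]) auto
  also have "\<dots> = (LINT x|m. char_fun \<omega> x * indicator A (x - t))"
  proof -
    have "char_fun \<omega> t * (char_fun \<omega> (x - t) * indicator A (x - t))
        = char_fun \<omega> x * indicator A (x - t)" for x
      using char_fun_add[of \<omega> t "x - t"] by simp
    then show ?thesis
      unfolding integral_mult_right_zero[symmetric]
      by (rule Bochner_Integration.integral_cong[OF refl])
  qed
  finally have "(char_fun \<omega> t - 1) * (LINT x|m. char_fun \<omega> x * indicator A x)
      = (LINT x|m. char_fun \<omega> x * indicator A (x - t) - char_fun \<omega> x * indicator A x)"
    by (simp add: left_diff_distrib Bochner_Integration.integral_diff[OF i2 i1])
  then have "cmod (char_fun \<omega> t - 1) * cmod (LINT x|m. char_fun \<omega> x * indicator A x)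
      = cmod (LINT x|m. char_fun \<omega> x * indicator A (x - t) - char_fun \<omega> x * indicator A x)"
    by (metis norm_mult)
  also have "\<dots> \<le> (LINT x|m. cmod (char_fun \<omega> x * indicator A (x - t) - char_fun \<omega> x * indicator A x))"
    by (rule integral_norm_bound)
  \<comment> \<open>The modulus of the difference of two indicators is twice the positive part minus
    the difference itself. The positive part lives on \<open>C\<close> and the difference integrates
    to 0 by invariance, whence the constant 2.\<close>
  also have "\<dots> \<le> (LINT x|m. 2 * indicator C x - (indicator A (x - t) - indicator A x))"
  proof (rule integral_mono)
    show "integrable m (\<lambda>x. cmod (char_fun \<omega> x * indicator A (x - t) - char_fun \<omega> x * indicator A x))"
      using i1 i2 by simp
    show "integrable m (\<lambda>x. 2 * indicator C x - (indicator A (x - t) - indicator A x) :: real)"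
      by (intro Bochner_Integration.integrable_diff iC iA iAt)
    show "cmod (char_fun \<omega> x * indicator A (x - t) - char_fun \<omega> x * indicator A x)
        \<le> 2 * indicator C x - (indicator A (x - t) - indicator A x)" for x
      by (cases "x - t \<in> A"; cases "x \<in> A"; cases "x \<in> C") (simp_all add: CI)
  qed
  also have "\<dots> = 2 * measure m C"
    by (subst Bochner_Integration.integral_diff[OF iC Bochner_Integration.integrable_diff[OF iAt iA]],
        subst Bochner_Integration.integral_diff[OF iAt iA],
        subst integral_translation[of "indicator A :: 'g \<Rightarrow> real" t]) simp_all
  also have "measure m C \<le> measure m (van_Hove_boundary {t} A)"
  proof (rule measure_mono_fmeasurable[OF _ _ V])
    have "{a + k |a k. a \<in> A \<and> k \<in> {t}} = (\<lambda>a. a + t) ` A"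
      by auto
    then show "C \<subseteq> van_Hove_boundary {t} A"
      by (simp add: van_Hove_boundary_def C_def)
    show "C \<in> sets m"
      using C by (simp add: fmeasurable_def)
  qed
  finally show ?thesis by simp
qed

text \<open>Density of the uniform distribution on \<open>A\<close> with respect to
  \<open>m\<close>; complex-valued so that \<open>fun_convolution\<close> and
  \<open>inverse_fourier\<close> apply to it.\<close>

definition average_kernel :: "'g set \<Rightarrow> 'g \<Rightarrow> complex" where
  "average_kernel A x = indicator A x / complex_of_real (measure m A)"

lemma average_kernel_integrable:
  assumes "compact A"
  shows "integrable m (average_kernel A)"
  unfolding average_kernel_def
  by (intro integrable_divide integrable_complex_indicator compact_finite_measure assms)

lemma inverse_fourier_average_kernel:
  "inverse_fourier m (average_kernel A) \<omega> =
     (LINT x|m. char_fun \<omega> x * indicator A x) / complex_of_real (measure m A)"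
  by (simp add: inverse_fourier_def average_kernel_def)

lemma inverse_fourier_average_kernel_0:
  assumes "compact A" "measure m A > 0"
  shows "inverse_fourier m (average_kernel A) 0 = 1"
  using integral_complex_indicator[OF compact_finite_measure[OF assms(1)]] assms(2)
  by (simp add: inverse_fourier_average_kernel)

lemma cmod_inverse_fourier_average_kernel_le:
  assumes "compact A" "measure m A > 0"
  shows "cmod (inverse_fourier m (average_kernel A) \<omega>) \<le> 1"
proof -
  have "cmod (average_kernel A x) = indicator A x / measure m A" for x
    using assms(2) by (simp add: average_kernel_def norm_divide indicator_def)
  then have "(LINT x|m. cmod (average_kernel A x)) = 1"
    using compact_finite_measure[OF assms(1)] assms(2) by (simp add: fmeasurable_def)
  then show ?thesis
    using cmod_inverse_fourier_le[of m "average_kernel A" \<omega>] by simp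
qed

text \<open>A nontrivial character satisfies \<open>char_fun \<omega> t \<noteq> 1\<close> for some
  t. Dividing the boundary estimate by \<open>cmod (char_fun \<omega> t - 1)\<close> and by the
  measure of \<open>A n\<close> leaves a multiple of the van Hove quotient for the compact set
  \<open>{t}\<close>.\<close>

lemma inverse_fourier_average_kernel_tendsto_0:
  assumes A: "van_Hove_sequence m A" and \<omega>: "\<omega> \<noteq> 0"
  shows "(\<lambda>n. inverse_fourier m (average_kernel (A n)) \<omega>) \<longlonglongrightarrow> 0"
proof -
  have "char_fun \<omega> \<noteq> char_fun 0"
    using \<omega> by (simp add: char_fun_inject)
  then obtain t where t: "char_fun \<omega> t \<noteq> 1"
    by (auto simp: fun_eq_iff)
  have An: "compact (A n)" "measure m (A n) > 0" for n
    using A by (auto simp: van_Hove_sequence_def)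
  have lim: "(\<lambda>n. measure m (van_Hove_boundary {t} (A n)) / measure m (A n)) \<longlonglongrightarrow> 0"
    using A by (simp add: van_Hove_sequence_def)
  show ?thesis
  proof (rule Lim_null_comparison)
    let ?c = "2 / cmod (char_fun \<omega> t - 1)"
    show "(\<lambda>n. ?c * (measure m (van_Hove_boundary {t} (A n)) / measure m (A n))) \<longlonglongrightarrow> 0"
      using tendsto_mult_right_zero[OF lim] .
    show "\<forall>\<^sub>F n in sequentially. norm (inverse_fourier m (average_kernel (A n)) \<omega>)
        \<le> ?c * (measure m (van_Hove_boundary {t} (A n)) / measure m (A n))"
    proof (intro always_eventually allI)
      fix n
      show "norm (inverse_fourier m (average_kernel (A n)) \<omega>)
        \<le> ?c * (measure m (van_Hove_boundary {t} (A n)) / measure m (A n))"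
        using char_integral_le_van_Hove_boundary[OF An(1), of \<omega> t n] An(2)[of n] t
        by (simp add: inverse_fourier_average_kernel norm_divide field_simps)
    qed
  qed
qed

text \<open>Convolving \<open>f\<close> with the averages over \<open>A n\<close> makes \<open>inverse_fourier\<close> concentrate at the trivial
  character, while the square integrable function \<open>inverse_fourier m f\<close> remains a majorant.\<close>

lemma intensity_as_limit:
  assumes A: "van_Hove_sequence m A" and f: "f \<in> C_c" and \<gamma>h: "fourier_transform m \<gamma> \<gamma>h"
  shows "(\<lambda>n. LINT \<omega>|\<gamma>h. (cmod (inverse_fourier m
            (\<lambda>x. char_fun \<eta> x * fun_convolution m (average_kernel (A n)) f x) \<omega>))\<^sup>2)
          \<longlonglongrightarrow> (cmod (integral\<^sup>L m f))\<^sup>2 * intensity \<gamma>h (- \<eta>)"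
proof -
  let ?\<phi> = "\<lambda>n x. char_fun \<eta> x * fun_convolution m (average_kernel (A n)) f x"
  let ?w = "\<lambda>\<omega>. (cmod (inverse_fourier m (\<lambda>x. char_fun \<eta> x * f x) \<omega>))\<^sup>2"
  let ?l = "\<lambda>\<omega>. indicator {- \<eta>} \<omega> * (cmod (integral\<^sup>L m f))\<^sup>2"
  have An: "compact (A n)" "measure m (A n) > 0" for n
    using A by (auto simp: van_Hove_sequence_def)
  have sets: "sets \<gamma>h = sets borel" and fin: "emeasure \<gamma>h {- \<eta>} < \<infinity>"
    using \<gamma>h by (auto simp: fourier_transform_def radon_measure_def)
  have fi: "integrable m f"
    using f radon by (rule C_c_integrable)
  have split: "inverse_fourier m (?\<phi> n) \<omega> =
      inverse_fourier m (average_kernel (A n)) (\<omega> + \<eta>) * inverse_fourier m f (\<omega> + \<eta>)" for n \<omega>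
    unfolding inverse_fourier_char_mult
    by (rule inverse_fourier_fun_convolution[OF average_kernel_integrable[OF An(1)] fi])
  have "?\<phi> n \<in> C_c" for n
  proof (rule C_c_mult)
    show "fun_convolution m (average_kernel (A n)) f \<in> C_c"
      by (rule fun_convolution_in_C_c[OF average_kernel_integrable[OF An(1)[of n]] An(1)[of n] _ f])
        (simp add: average_kernel_def)
  qed (rule continuous_on_char_fun)
  then have int: "integrable \<gamma>h (\<lambda>\<omega>. (cmod (inverse_fourier m (?\<phi> n) \<omega>))\<^sup>2)" for n
    using \<gamma>h by (simp add: fourier_transform_def)
  have "(\<lambda>n. LINT \<omega>|\<gamma>h. (cmod (inverse_fourier m (?\<phi> n) \<omega>))\<^sup>2) \<longlonglongrightarrow> (LINT \<omega>|\<gamma>h. ?l \<omega>)"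
  proof (rule integral_dominated_convergence)
    show "?l \<in> borel_measurable \<gamma>h"
      by (simp add: measurable_cong_sets[OF sets refl])
    show "(\<lambda>\<omega>. (cmod (inverse_fourier m (?\<phi> n) \<omega>))\<^sup>2) \<in> borel_measurable \<gamma>h" for n
      using int by (rule borel_measurable_integrable)
    \<comment> \<open>The majorant is itself the squared transform of a function in
      \<open>C_c\<close>, so the integrability clause of \<open>fourier_transform\<close> covers
      it.\<close>
    have "(\<lambda>x. char_fun \<eta> x * f x) \<in> C_c"
      by (intro C_c_mult continuous_on_char_fun f)
    then show "integrable \<gamma>h ?w"
      using \<gamma>h by (simp add: fourier_transform_def)
    show "AE \<omega> in \<gamma>h. norm ((cmod (inverse_fourier m (?\<phi> n) \<omega>))\<^sup>2) \<le> ?w \<omega>" for n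
    proof (intro always_eventually allI)
      fix \<omega>
      show "norm ((cmod (inverse_fourier m (?\<phi> n) \<omega>))\<^sup>2) \<le> ?w \<omega>"
        using cmod_inverse_fourier_average_kernel_le[OF An, of n "\<omega> + \<eta>"]
        unfolding split by (simp add: inverse_fourier_char_mult norm_mult power_mono mult_left_le_one_le)
    qed
    show "AE \<omega> in \<gamma>h. (\<lambda>n. (cmod (inverse_fourier m (?\<phi> n) \<omega>))\<^sup>2) \<longlonglongrightarrow> ?l \<omega>"
    proof (intro always_eventually allI)
      fix \<omega>
      show "(\<lambda>n. (cmod (inverse_fourier m (?\<phi> n) \<omega>))\<^sup>2) \<longlonglongrightarrow> ?l \<omega>"
      \<comment> \<open>At \<open>- \<eta>\<close> the transform of every averaging kernel is
        exactly 1 and the sequence is constant; at all other characters the kernel factor tends to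
        0.\<close>
      proof (cases "\<omega> + \<eta> = 0")
        case True
        have "integral\<^sup>L m f = inverse_fourier m f 0"
          by (simp add: inverse_fourier_zero)
        with True show ?thesis
          unfolding split by (simp add: inverse_fourier_average_kernel_0[OF An] eq_neg_iff_add_eq_0)
      next
        case False
        have "(\<lambda>n. (cmod (inverse_fourier m (?\<phi> n) \<omega>))\<^sup>2) \<longlonglongrightarrow> (cmod (0 * inverse_fourier m f (\<omega> + \<eta>)))\<^sup>2"
          unfolding split
          by (intro tendsto_intros inverse_fourier_average_kernel_tendsto_0[OF A False])
        then show ?thesis
          using False by (simp add: eq_neg_iff_add_eq_0)
      qed
    qed
  qed
  also have "(LINT \<omega>|\<gamma>h. ?l \<omega>) = (cmod (integral\<^sup>L m f))\<^sup>2 * intensity \<gamma>h (- \<eta>)"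
    using fin by (simp add: intensity_def sets)
  finally show ?thesis .
qed

end

section \<open>Autocorrelations\<close>

lemma closed_measure_support: "closed (measure_support \<mu>)"
proof -
  have "- measure_support \<mu> = \<Union>{U. open U \<and> emeasure \<mu> U = 0}"
    by (auto simp: measure_support_def)
  then have "open (- measure_support \<mu>)"
    by (simp only:) (rule open_Union, auto)
  then show ?thesis
    by (simp add: closed_def)
qed

text \<open>The complement of the support is the union of all open null sets. Second countability,
  through Lindelof, makes it a countable union of such sets and hence null.\<close>

lemma AE_measure_support:
  fixes \<mu> :: "'a::second_countable_topology measure"
  assumes sets: "sets \<mu> = sets borel"
  shows "AE x in \<mu>. x \<in> measure_support \<mu>"
proof -
  let ?F = "{U. open U \<and> emeasure \<mu> U = 0}"
  obtain F where F: "F \<subseteq> ?F" "countable F" "\<Union>F = \<Union>?F"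
    using Lindelof[of ?F] by auto
  have "(\<Union>U\<in>F. U) \<in> null_sets \<mu>"
    using F(1) by (intro null_sets_UN' F(2)) (auto simp: null_sets_def sets)
  then have "\<Union>?F \<in> null_sets \<mu>"
    by (simp add: F(3))
  then show ?thesis
    by (rule AE_I') (auto simp: measure_support_def)
qed

lemma AE_scale_measure:
  assumes "AE x in M. P x"
  shows "AE x in scale_measure r M. P x"
proof -
  obtain N where N: "{x \<in> space M. \<not> P x} \<subseteq> N" "emeasure M N = 0" "N \<in> sets M"
    using assms by (rule AE_E)
  show ?thesis
    by (rule AE_I[of _ _ N]) (use N in \<open>simp_all add: space_scale_measure\<close>)
qed

text \<open>A finite autocorrelation is a scaled push-forward, under subtraction, of the product of
  \<open>\<mu>\<close> restricted to \<open>A\<close> with itself. Both factors are concentrated on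
  the support, so a property of all differences of support points holds almost everywhere;
  closedness supplies measurability.\<close>

lemma
  fixes \<mu> :: "'g::{topological_ab_group_add,t2_space,second_countable_topology} measure"
  assumes \<mu>: "radon_measure \<mu>" and A: "compact A" "measure m A > 0"
  shows finite_measure_finite_autocorrelation: "finite_measure (finite_autocorrelation m \<mu> A)"
    and AE_finite_autocorrelation:
      "\<lbrakk>\<And>x y. x \<in> measure_support \<mu> \<Longrightarrow> y \<in> measure_support \<mu> \<Longrightarrow> P (x - y); closed {x. P x}\<rbrakk>
        \<Longrightarrow> AE x in finite_autocorrelation m \<mu> A. P x"
proof -
  define M where "M = density \<mu> (indicator A)"
  define N where "N = distr M borel uminus"
  have sets_\<mu>: "sets \<mu> = sets borel"
    using \<mu> by (simp add: radon_measure_def)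
  have A_sets: "A \<in> sets \<mu>"
    using A by (simp add: sets_\<mu> compact_imp_closed)
  have sets_M: "sets M = sets borel" and sets_N: "sets N = sets borel"
    by (simp_all add: M_def N_def sets_\<mu>)
  have uminus: "uminus \<in> measurable M borel"
    using sets_M by (auto simp: measurable_cong_sets[OF sets_M refl]
        intro!: borel_measurable_continuous_onI continuous_intros)
  have "emeasure M (space M) = emeasure \<mu> A"
    using A_sets sets.sets_into_space[OF A_sets]
    by (simp add: M_def emeasure_density nn_integral_indicator Int_absorb1 flip: indicator_inter_arith)
  also have "\<dots> < \<infinity>"
    using \<mu> A by (simp add: radon_measure_def)
  finally interpret M: finite_measure M
    by (intro finite_measureI) simp
  interpret N: finite_measure N
    unfolding N_def by (rule M.finite_measure_distr[OF uminus])
  interpret MN: pair_sigma_finite M N ..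
  have finite_MN: "finite_measure (M \<Otimes>\<^sub>M N)"
    by (rule finite_measure_pair_measure) unfold_locales
  \<comment> \<open>By second countability the product sigma-algebra is the Borel one, so the
    continuous map of addition is measurable for it.\<close>
  have sets_MN: "sets (M \<Otimes>\<^sub>M N) = sets borel"
    by (rule trans[OF sets_pair_measure_cong[OF sets_M sets_N] arg_cong[of _ _ sets, OF borel_prod]])
  have add: "(\<lambda>(x, y). x + y) \<in> measurable (M \<Otimes>\<^sub>M N) borel"
    unfolding measurable_cong_sets[OF sets_MN refl] case_prod_beta
    by (intro borel_measurable_continuous_onI continuous_intros)
  have eq: "finite_autocorrelation m \<mu> A =
      scale_measure (1 / emeasure m A) (distr (M \<Otimes>\<^sub>M N) borel (\<lambda>(x, y). x + y))"
    by (simp add: finite_autocorrelation_def measure_convolution_def reflected_measure_def M_def N_def)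
  interpret D: finite_measure "distr (M \<Otimes>\<^sub>M N) borel (\<lambda>(x, y). x + y)"
    by (rule finite_measure.finite_measure_distr[OF finite_MN add])
  show "finite_measure (finite_autocorrelation m \<mu> A)"
  proof (rule finite_measureI)
    \<comment> \<open>In the extended reals division by 0 gives infinity, so the scaling factor is
      finite only because \<open>A\<close> has nonzero measure.\<close>
    have "emeasure m A \<noteq> 0"
      using A(2) by (auto simp: measure_def)
    then have "1 / emeasure m A < \<infinity>"
      by (simp add: divide_ennreal_def less_top[symmetric])
    then show "emeasure (finite_autocorrelation m \<mu> A) (space (finite_autocorrelation m \<mu> A)) \<noteq> \<infinity>"
      using D.emeasure_finite by (simp add: eq ennreal_mult_eq_top_iff less_top)
  qed
  assume P: "\<And>x y. x \<in> measure_support \<mu> \<Longrightarrow> y \<in> measure_support \<mu> \<Longrightarrow> P (x - y)"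
    and closed: "closed {x. P x}"
  have AE_M: "AE x in M. x \<in> measure_support \<mu>"
    unfolding M_def using AE_measure_support[OF sets_\<mu>] A_sets by (subst AE_density) auto
  have AE_N: "AE y in N. - y \<in> measure_support \<mu>"
    unfolding N_def
  proof (subst AE_distr_iff[OF uminus])
    have "closed (uminus -` measure_support \<mu>)"
      by (intro closed_vimage closed_measure_support continuous_intros)
    then show "{x \<in> space borel. - x \<in> measure_support \<mu>} \<in> sets borel"
      by (simp add: vimage_def)
    show "AE x in M. - (- x) \<in> measure_support \<mu>"
      using AE_M by simp
  qed
  have closed2: "closed {z :: 'g \<times> 'g. P (fst z + snd z)}"
    using closed_vimage[OF closed, of "\<lambda>z :: 'g \<times> 'g. fst z + snd z"]
    by (simp add: vimage_def continuous_intros)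
  have "AE z in M \<Otimes>\<^sub>M N. P (fst z + snd z)"
  proof (rule MN.AE_pair_measure)
    show "{z \<in> space (M \<Otimes>\<^sub>M N). P (fst z + snd z)} \<in> sets (M \<Otimes>\<^sub>M N)"
      using closed2 sets_eq_imp_space_eq[OF sets_MN] by (simp add: sets_MN)
    show "AE x in M. AE y in N. P (fst (x, y) + snd (x, y))"
      using AE_M
    proof eventually_elim
      case (elim x)
      show ?case
        using AE_N
      proof eventually_elim
        case (elim y)
        then show ?case
          using P[OF \<open>x \<in> measure_support \<mu>\<close>, of "- y"] by simp
      qed
    qed
  qed
  then have "AE z in distr (M \<Otimes>\<^sub>M N) borel (\<lambda>(x, y). x + y). P z"
    using closed by (subst AE_distr_iff[OF add]) (simp_all add: case_prod_beta)
  then show "AE x in finite_autocorrelation m \<mu> A. P x"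
    unfolding eq by (rule AE_scale_measure)
qed

lemma sets_finite_autocorrelation: "sets (finite_autocorrelation m \<mu> A) = sets borel"
  by (simp add: finite_autocorrelation_def measure_convolution_def)

section \<open>Deviation estimates for autocorrelations and comparison of intensities\<close>

context lc_haar
begin

text \<open>The estimate is proved for every finite autocorrelation, which is concentrated on
  differences of support points, and then passes to the vague limit because both integrands lie in
  \<open>C_c\<close>. Nonnegativity of \<open>h\<close> turns the integral of its modulus into the
  integral of \<open>h\<close>, which converges as well.\<close>

lemma autocorrelation_char_deviation:
  assumes \<mu>: "radon_measure \<mu>" and \<gamma>: "autocorrelation m \<mu> \<gamma>"
    and s: "\<And>x y. x \<in> measure_support \<mu> \<Longrightarrow> y \<in> measure_support \<mu> \<Longrightarrow> cmod (char_fun \<eta> (x - y) - 1) \<le> s"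
    and h: "h \<in> C_c" "\<And>x. h x = complex_of_real (cmod (h x))"
  shows "cmod ((LINT x|\<gamma>. char_fun \<eta> x * h x) - (LINT x|\<gamma>. h x)) \<le> s * Re (LINT x|\<gamma>. h x)"
proof -
  obtain A r where A: "van_Hove_sequence m A"
    and lim: "vague_limit (\<lambda>n. finite_autocorrelation m \<mu> (A (r n))) \<gamma>"
    using \<gamma> by (auto simp: autocorrelation_def)
  define \<nu> where "\<nu> n = finite_autocorrelation m \<mu> (A (r n))" for n
  have An: "compact (A n)" "measure m (A n) > 0" for n
    using A by (auto simp: van_Hove_sequence_def)
  have eh: "(\<lambda>x. char_fun \<eta> x * h x) \<in> C_c"
    by (intro C_c_mult continuous_on_char_fun h)
  have lim_h: "(\<lambda>n. LINT x|\<nu> n. h x) \<longlonglongrightarrow> (LINT x|\<gamma>. h x)"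
    and lim_eh: "(\<lambda>n. LINT x|\<nu> n. char_fun \<eta> x * h x) \<longlonglongrightarrow> (LINT x|\<gamma>. char_fun \<eta> x * h x)"
    using lim h(1) eh by (simp_all add: vague_limit_def \<nu>_def)
  have bound: "cmod ((LINT x|\<nu> n. char_fun \<eta> x * h x) - (LINT x|\<nu> n. h x)) \<le> s * Re (LINT x|\<nu> n. h x)"
    for n
  proof -
    interpret \<nu>: finite_measure "\<nu> n"
      unfolding \<nu>_def by (rule finite_measure_finite_autocorrelation[OF \<mu> An])
    have "radon_measure (\<nu> n)"
      using \<nu>.emeasure_finite by (simp add: radon_measure_def \<nu>_def sets_finite_autocorrelation less_top)
    then have int: "integrable (\<nu> n) h" "integrable (\<nu> n) (\<lambda>x. char_fun \<eta> x * h x)"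
      using h(1) eh by (auto intro: C_c_integrable)
    have "closed ((\<lambda>x. cmod (char_fun \<eta> x - 1)) -` {..s})"
      by (intro closed_vimage continuous_intros)
    then have "AE x in \<nu> n. cmod (char_fun \<eta> x - 1) \<le> s"
      unfolding \<nu>_def by (intro AE_finite_autocorrelation[OF \<mu> An] s) (auto simp: vimage_def)
    then have "(LINT x|\<nu> n. cmod (char_fun \<eta> x * h x - h x)) \<le> (LINT x|\<nu> n. s * cmod (h x))"
    proof (intro integral_mono_AE, goal_cases)
      case 3
      then show ?case
      proof eventually_elim
        case (elim x)
        have "cmod (char_fun \<eta> x * h x - h x) = cmod (char_fun \<eta> x - 1) * cmod (h x)"
          by (simp add: left_diff_distrib flip: norm_mult)
        then show ?case
          using elim by (simp add: mult_right_mono)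
      qed
    qed (use int in simp_all)
    moreover have "(LINT x|\<nu> n. cmod (h x)) = Re (LINT x|\<nu> n. h x)"
    proof -
      have "(LINT x|\<nu> n. h x) = (LINT x|\<nu> n. complex_of_real (cmod (h x)))"
        by (rule Bochner_Integration.integral_cong[OF refl h(2)])
      then show ?thesis
        by (simp add: integral_complex_of_real)
    qed
    moreover have "cmod ((LINT x|\<nu> n. char_fun \<eta> x * h x) - (LINT x|\<nu> n. h x))
        \<le> (LINT x|\<nu> n. cmod (char_fun \<eta> x * h x - h x))"
      by (subst Bochner_Integration.integral_diff[OF int(2,1), symmetric]) (rule integral_norm_bound)
    ultimately show ?thesis
      by simp
  qed
  show ?thesis
  proof (rule LIMSEQ_le)
    show "(\<lambda>n. cmod ((LINT x|\<nu> n. char_fun \<eta> x * h x) - (LINT x|\<nu> n. h x)))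
        \<longlonglongrightarrow> cmod ((LINT x|\<gamma>. char_fun \<eta> x * h x) - (LINT x|\<gamma>. h x))"
      by (intro tendsto_intros lim_h lim_eh)
    show "(\<lambda>n. s * Re (LINT x|\<nu> n. h x)) \<longlonglongrightarrow> s * Re (LINT x|\<gamma>. h x)"
      by (intro tendsto_intros lim_h)
  qed (use bound in blast)
qed

text \<open>With \<open>h\<close> the convolution square of \<open>\<phi>\<close>, the two integrals
  over \<open>\<gamma>\<close> are \<open>?Q\<close> and, by
  \<open>fun_convolution_char_mult\<close>, \<open>?P\<close>. The deviation estimate bounds the
  distance of \<open>?P\<close> and \<open>?Q\<close> by \<open>s * ?Q\<close>.\<close>

lemma fourier_transform_shift_ge:
  assumes \<mu>: "radon_measure \<mu>" and \<gamma>: "autocorrelation m \<mu> \<gamma>" "fourier_transform m \<gamma> \<gamma>h"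
    and s: "\<And>x y. x \<in> measure_support \<mu> \<Longrightarrow> y \<in> measure_support \<mu> \<Longrightarrow> cmod (char_fun \<eta> (x - y) - 1) \<le> s"
    and \<phi>: "\<phi> \<in> C_c" "\<And>x. \<phi> x = complex_of_real (cmod (\<phi> x))"
  shows "(1 - s) * (LINT \<omega>|\<gamma>h. (cmod (inverse_fourier m \<phi> \<omega>))\<^sup>2)
    \<le> (LINT \<omega>|\<gamma>h. (cmod (inverse_fourier m (\<lambda>x. char_fun \<eta> x * \<phi> x) \<omega>))\<^sup>2)"
    (is "_ * ?Q \<le> ?P")
proof -
  let ?h = "fun_convolution m \<phi> (tilde \<phi>)"
  obtain K B where K: "continuous_on UNIV \<phi>" "compact K" "\<And>x. x \<notin> K \<Longrightarrow> \<phi> x = 0"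
    "\<And>x. cmod (\<phi> x) \<le> B"
    using C_cE[OF \<phi>(1)] by metis
  have h: "?h \<in> C_c"
    by (intro fun_convolution_in_C_c[OF C_c_integrable[OF \<phi>(1) radon] K(2,3)] tilde_in_C_c \<phi>)
  have "(\<lambda>x. char_fun \<eta> x * \<phi> x) \<in> C_c"
    by (intro C_c_mult continuous_on_char_fun \<phi>)
  then have "(LINT x|\<gamma>. char_fun \<eta> x * ?h x) = complex_of_real ?P"
    unfolding fun_convolution_char_mult[symmetric] using \<gamma>(2) by (simp add: fourier_transform_def)
  moreover have "(LINT x|\<gamma>. ?h x) = complex_of_real ?Q"
    using \<gamma>(2) \<phi>(1) by (simp add: fourier_transform_def)
  ultimately have "cmod (complex_of_real (?P - ?Q)) \<le> s * ?Q"
    using autocorrelation_char_deviation[OF \<mu> \<gamma>(1) s h fun_convolution_nonneg[OF \<phi>(2)]]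
    by simp
  then have "\<bar>?P - ?Q\<bar> \<le> s * ?Q"
    by (simp only: norm_of_real)
  then show ?thesis
    by (simp add: left_diff_distrib)
qed

lemma intensity_ge:
  assumes \<mu>: "radon_measure \<mu>" and \<gamma>: "autocorrelation m \<mu> \<gamma>" "fourier_transform m \<gamma> \<gamma>h"
    and s: "\<And>x y. x \<in> measure_support \<mu> \<Longrightarrow> y \<in> measure_support \<mu> \<Longrightarrow> cmod (char_fun \<omega> (x - y) - 1) \<le> s"
  shows "(1 - s) * intensity \<gamma>h 0 \<le> intensity \<gamma>h \<omega>"
proof -
  \<comment> \<open>This sequence serves only for averaging test functions; its link with the
    definition of \<open>\<gamma>\<close> no longer matters.\<close>
  obtain A where A: "van_Hove_sequence m A"
    using \<gamma>(1) by (auto simp: autocorrelation_def)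
  obtain f where f: "f \<in> C_c" "\<And>x. f x = complex_of_real (cmod (f x))" "integral\<^sup>L m f \<noteq> 0"
    using exists_C_c_positive_integral by blast
  define \<phi> where "\<phi> n = fun_convolution m (average_kernel (A n)) f" for n
  have An: "compact (A n)" for n
    using A by (auto simp: van_Hove_sequence_def)
  have \<phi>: "\<phi> n \<in> C_c" for n
    unfolding \<phi>_def
    by (rule fun_convolution_in_C_c[OF average_kernel_integrable[OF An[of n]] An[of n] _ f(1)])
      (simp add: average_kernel_def)
  have \<phi>_nonneg: "\<phi> n x = complex_of_real (cmod (\<phi> n x))" for n x
  proof -
    let ?g = "\<lambda>y. indicator (A n) y / measure m (A n) * cmod (f (x - y))"
    have "average_kernel (A n) y * f (x - y) = complex_of_real (?g y)" for y
      by (subst f(2)) (simp add: average_kernel_def indicator_def)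
    then have "\<phi> n x = complex_of_real (LINT y|m. ?g y)"
      by (simp only: \<phi>_def fun_convolution_def integral_complex_of_real)
    moreover have "0 \<le> (LINT y|m. ?g y)"
      by (intro integral_nonneg_AE) auto
    ultimately show ?thesis
      by (simp only: norm_of_real abs_of_nonneg)
  qed
  \<comment> \<open>Modulation by \<open>\<eta>\<close> detects the intensity at
    \<open>- \<eta>\<close>, so the shift estimate is used with \<open>- \<omega>\<close>;
    conjugation preserves the distance to 1.\<close>
  have s': "cmod (char_fun (- \<omega>) (x - y) - 1) \<le> s"
    if "x \<in> measure_support \<mu>" "y \<in> measure_support \<mu>" for x y
  proof -
    have "cmod (char_fun (- \<omega>) (x - y) - 1) = cmod (cnj (char_fun \<omega> (x - y) - 1))"
      by (simp add: char_fun_character_minus)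
    then show ?thesis
      using s[OF that] by (simp only: complex_mod_cnj)
  qed
  have ineq: "(1 - s) * (LINT \<psi>|\<gamma>h. (cmod (inverse_fourier m (\<phi> n) \<psi>))\<^sup>2)
      \<le> (LINT \<psi>|\<gamma>h. (cmod (inverse_fourier m (\<lambda>x. char_fun (- \<omega>) x * \<phi> n x) \<psi>))\<^sup>2)" for n
    by (rule fourier_transform_shift_ge[OF \<mu> \<gamma> s' \<phi> \<phi>_nonneg])
  have lim: "(\<lambda>n. LINT \<psi>|\<gamma>h. (cmod (inverse_fourier m (\<lambda>x. char_fun \<eta> x * \<phi> n x) \<psi>))\<^sup>2)
      \<longlonglongrightarrow> (cmod (integral\<^sup>L m f))\<^sup>2 * intensity \<gamma>h (- \<eta>)" for \<eta>
    unfolding \<phi>_def by (rule intensity_as_limit[OF A f(1) \<gamma>(2)])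
  have "(1 - s) * ((cmod (integral\<^sup>L m f))\<^sup>2 * intensity \<gamma>h 0)
      \<le> (cmod (integral\<^sup>L m f))\<^sup>2 * intensity \<gamma>h \<omega>"
    \<comment> \<open>The choice \<open>\<eta> = 0\<close> yields the intensity at 0 and
      \<open>\<eta> = - \<omega>\<close> the one at \<open>\<omega>\<close>. The common factor is
      positive by the choice of \<open>f\<close> and cancels afterwards.\<close>
    using tendsto_mult_left[OF lim[of 0], of "1 - s"] lim[of "- \<omega>"] ineq
    by (intro LIMSEQ_le) auto
  then have "(cmod (integral\<^sup>L m f))\<^sup>2 * ((1 - s) * intensity \<gamma>h 0)
      \<le> (cmod (integral\<^sup>L m f))\<^sup>2 * intensity \<gamma>h \<omega>"
    by (simp only: mult.left_commute)
  then show ?thesis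
    using f(3) by (simp add: mult_le_cancel_left)
qed

end


section \<open>Characters of the dual lattice\<close>

text \<open>Two partners of \<open>\<omega>\<close> agree on the projection of \<open>L\<close>,
  since both invert the same values of \<open>\<omega>\<close>; continuity and density make them
  equal. This justifies the definite description in \<open>star_map\<close>.\<close>

lemma star_map_eq:
  assumes L: "closure (snd ` L) = UNIV" and \<psi>: "(\<omega>, \<psi>) \<in> annihilator L"
  shows "star_map L \<omega> = \<psi>"
  unfolding star_map_def
proof (rule the_equality)
  fix \<psi>' assume \<psi>': "(\<omega>, \<psi>') \<in> annihilator L"
  have eq: "char_fun \<psi>' y = char_fun \<psi> y" if y: "y \<in> snd ` L" for y
  proof -
    obtain x where x: "(x, y) \<in> L"
      using y by auto
    have "char_fun \<omega> x * char_fun \<psi> y = 1" "char_fun \<omega> x * char_fun \<psi>' y = 1"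
      using \<psi> \<psi>' x by (auto simp: annihilator_def)
    then show ?thesis
      by (metis mult_cancel_left mult_zero_left zero_neq_one)
  qed
  have "closed ((\<lambda>y. char_fun \<psi>' y - char_fun \<psi> y) -` {0})"
    by (intro closed_vimage continuous_intros)
  moreover have "snd ` L \<subseteq> (\<lambda>y. char_fun \<psi>' y - char_fun \<psi> y) -` {0}"
    by (rule subsetI) (simp add: eq)
  ultimately have "closure (snd ` L) \<subseteq> (\<lambda>y. char_fun \<psi>' y - char_fun \<psi> y) -` {0}"
    by (rule closure_minimal[rotated])
  then have "y \<in> (\<lambda>y. char_fun \<psi>' y - char_fun \<psi> y) -` {0}" for y
    using L by blast
  then have "char_fun \<psi>' = char_fun \<psi>"
    by (simp add: fun_eq_iff)
  then show "\<psi>' = \<psi>"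
    by (simp add: char_fun_inject)
qed (fact \<psi>)

text \<open>The difference of two lattice points is a lattice point, on which the annihilator
  relation makes the value of \<open>\<omega>\<close> the conjugate of that of
  \<open>\<psi>\<close>. Conjugation does not change the distance to 1.\<close>

lemma char_deviation_cut_set:
  assumes \<psi>: "(\<omega>, \<psi>) \<in> annihilator L" and L: "subgroup L"
    and x: "x \<in> cut_set L W" "x' \<in> cut_set L W"
  shows "\<exists>t\<in>difference_set W W. cmod (char_fun \<omega> (x - x') - 1) = cmod (char_fun \<psi> t - 1)"
proof -
  obtain y y' where y: "(x, y) \<in> L" "(x', y') \<in> L" "y \<in> W" "y' \<in> W"
    using x by (auto simp: cut_set_def)
  then have "(x - x', y - y') \<in> L"
    using L by (metis diff_Pair subgroup_def)
  then have "char_fun \<omega> (x - x') * char_fun \<psi> (y - y') = 1"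
    using \<psi> by (auto simp: annihilator_def)
  then have "char_fun \<omega> (x - x') * (char_fun \<psi> (y - y') * cnj (char_fun \<psi> (y - y')))
      = cnj (char_fun \<psi> (y - y'))"
    by (metis mult.assoc mult_1_left)
  then have "char_fun \<omega> (x - x') - 1 = cnj (char_fun \<psi> (y - y') - 1)"
    by simp
  then have "cmod (char_fun \<omega> (x - x') - 1) = cmod (char_fun \<psi> (y - y') - 1)"
    by (simp only: complex_mod_cnj)
  then show ?thesis
    using y by (auto simp: difference_set_def)
qed

lemma compact_difference_set:
  fixes W :: "'h::{topological_ab_group_add,t2_space} set"
  assumes "compact W"
  shows "compact (difference_set W W)"
proof -
  have "difference_set W W = (\<lambda>(x, y). x - y) ` (W \<times> W)"
    by (auto simp: difference_set_def)
  also have "compact \<dots>"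
    unfolding case_prod_beta by (intro compact_continuous_image compact_Times continuous_intros assms)
  finally show ?thesis .
qed

section \<open>Lower bounds for the Bragg peaks\<close>

theorem theorem3p6:
  fixes m :: "'g::{topological_ab_group_add,t2_space,second_countable_topology} measure"
    and L :: "('g \<times> 'h::{topological_ab_group_add,t2_space}) set"
    and W :: "'h set"
    and \<mu> \<gamma> :: "'g measure"
    and \<gamma>h :: "'g character measure"
  assumes haar: "haar_measure m"
    and cps: "cut_and_project_scheme L"
    and window: "compact W"
    and mu: "radon_measure \<mu>" "translation_bounded \<mu>"
    and supp: "measure_support \<mu> \<subseteq> cut_set L W"
    and gamma: "autocorrelation m \<mu> \<gamma>"
    and gamma_hat: "fourier_transform m \<gamma> \<gamma>h"
    and I_pos: "intensity \<gamma>h 0 > 0"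
  shows "(\<forall>\<omega>\<in>dual_cut_set L W 1.
            bragg_peak \<gamma>h \<omega> \<and>
            intensity \<gamma>h \<omega> \<ge> (1 - star_deviation L W \<omega>) * intensity \<gamma>h 0 \<and>
            (1 - star_deviation L W \<omega>) * intensity \<gamma>h 0 > 0) \<and>
         (\<forall>\<epsilon>::real. 0 < \<epsilon> \<and> \<epsilon> < 1 \<longrightarrow>
            (\<forall>\<omega>\<in>dual_cut_set L W \<epsilon>.
               bragg_peak \<gamma>h \<omega> \<and>
               intensity \<gamma>h \<omega> \<ge> (1 - \<epsilon>) * intensity \<gamma>h 0))"
proof -
  interpret lc_haar m
    using haar cps by unfold_locales (auto simp: cut_and_project_scheme_def)
  let ?D = "difference_set W W"
  let ?I = "intensity \<gamma>h 0"
  have sub: "subgroup L" and dense: "closure (snd ` L) = UNIV"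
    using cps by (auto simp: cut_and_project_scheme_def lattice_in_def)
  have ge: "(1 - s) * ?I \<le> intensity \<gamma>h \<omega>"
    if "(\<omega>, \<psi>) \<in> annihilator L" "\<And>t. t \<in> ?D \<Longrightarrow> cmod (char_fun \<psi> t - 1) \<le> s" for \<omega> \<psi> s
  proof (rule intensity_ge[OF mu(1) gamma gamma_hat])
    fix x y assume "x \<in> measure_support \<mu>" "y \<in> measure_support \<mu>"
    then have "x \<in> cut_set L W" "y \<in> cut_set L W"
      using supp by auto
    from char_deviation_cut_set[OF that(1) sub this]
    obtain t where "t \<in> ?D" "cmod (char_fun \<omega> (x - y) - 1) = cmod (char_fun \<psi> t - 1)"
      by (elim bexE)
    then show "cmod (char_fun \<omega> (x - y) - 1) \<le> s"
      using that(2) by simp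
  qed
  \<comment> \<open>If \<open>W\<close> were empty, \<open>star_deviation\<close> would be a junk value; but then \<open>ge\<close> holds for negative \<open>s\<close> too.\<close>
  have "?D \<noteq> {}"
  proof
    assume "?D = {}"
    have "(0, 0) \<in> annihilator L"
      unfolding annihilator_def by auto
    \<comment> \<open>Over an empty \<open>?D\<close> the bound with \<open>s = - 1\<close> holds
      vacuously and makes twice \<open>?I\<close> at most \<open>?I\<close>, which contradicts
      positivity.\<close>
    then have "(1 - (- 1)) * ?I \<le> ?I"
      by (rule ge) (use \<open>?D = {}\<close> in blast)
    then show False
      using I_pos by simp
  qed
  \<comment> \<open>Stated for all \<open>\<epsilon> \<le> 1\<close> to serve both claims: the value
    1 gives (a), and the strict bound on \<open>star_deviation\<close> gives (b) for smaller
    values.\<close>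
  have part_a: "(1 - star_deviation L W \<omega>) * ?I \<le> intensity \<gamma>h \<omega> \<and>
      0 < (1 - star_deviation L W \<omega>) * ?I \<and> star_deviation L W \<omega> < \<epsilon>"
    if mem: "\<omega> \<in> dual_cut_set L W \<epsilon>" and "\<epsilon> \<le> 1" for \<omega> \<epsilon>
  proof -
    obtain \<psi> where \<psi>: "(\<omega>, \<psi>) \<in> annihilator L" "\<And>t. t \<in> ?D \<Longrightarrow> cmod (char_fun \<psi> t - 1) < \<epsilon>"
      using mem by (auto simp: dual_cut_set_def cut_set_def dual_window_def)
    have star: "star_map L \<omega> = \<psi>"
      using dense \<psi>(1) by (rule star_map_eq)
    \<comment> \<open>Pointwise strict bounds alone would only make the supremum at most \<epsilon>.
      Compactness of \<open>?D\<close> makes it a maximum, hence strictly smaller, so the lower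
      bound stays positive even for \<epsilon> = 1.\<close>
    have "\<exists>t\<in>?D. \<forall>u\<in>?D. cmod (char_fun \<psi> u - 1) \<le> cmod (char_fun \<psi> t - 1)"
      by (intro continuous_attains_sup compact_difference_set window \<open>?D \<noteq> {}\<close> continuous_intros)
    then obtain t where t: "t \<in> ?D" "\<And>u. u \<in> ?D \<Longrightarrow> cmod (char_fun \<psi> u - 1) \<le> cmod (char_fun \<psi> t - 1)"
      by blast
    have "star_deviation L W \<omega> = cmod (char_fun \<psi> t - 1)"
      unfolding star_deviation_def star by (rule cSup_eq_maximum) (use t in auto)
    then show ?thesis
      using ge[OF \<psi>(1) t(2)] \<psi>(2)[OF t(1)] \<open>\<epsilon> \<le> 1\<close> I_pos by auto
  qed
  have "bragg_peak \<gamma>h \<omega> \<and> (1 - \<epsilon>) * ?I \<le> intensity \<gamma>h \<omega>"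
    if "0 < \<epsilon>" "\<epsilon> < 1" "\<omega> \<in> dual_cut_set L W \<epsilon>" for \<omega> \<epsilon>
  proof -
    have "(1 - \<epsilon>) * ?I \<le> (1 - star_deviation L W \<omega>) * ?I"
      using part_a[OF that(3)] that(2) I_pos by (intro mult_right_mono) auto
    then show ?thesis
      using part_a[OF that(3)] that(2) by (auto simp: bragg_peak_def)
  qed
  moreover have "bragg_peak \<gamma>h \<omega> \<and>
      (1 - star_deviation L W \<omega>) * ?I \<le> intensity \<gamma>h \<omega> \<and>
      0 < (1 - star_deviation L W \<omega>) * ?I"
    if "\<omega> \<in> dual_cut_set L W 1" for \<omega>
    using part_a[OF that] by (auto simp: bragg_peak_def)
  ultimately show ?thesis
    by blast
qed

end
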